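(* Let $p$ be an odd prime and let $q\in\mathbb{C}_p$ with $|1-q|_p<1$. For every $n\in\mathbb{N}=\{1,2,3,\dots\}$, $$\int_{\mathbb{Z}_p}q^{-x}(1-x)^n\,d\mu_{-1}(x)=2+\frac{1}{q}\int_{\mathbb{Z}_p}x^n q^x\,d\mu_{-1}(x).$$
   Context: $\mathbb{C}_p$ denotes the completion of an algebraic closure of $\mathbb{Q}_p$. For $x\in\mathbb{Z}_p$ and $q\in\mathbb{C}_p$ with $|1-q|_p<1$, $q^x=\sum_{m\ge0}\binom{x}{m}(q-1)^m$ (and similarly $q^{-x}=(q^{-1})^x$). For a uniformly differentiable function $f:\mathbb{Z}_p\to\mathbb{C}_p$, the fermionic $p$-adic invariant integral is $$\int_{\mathbb{Z}_p}f(x)\,d\mu_{-1}(x)=\lim_{N\to\infty}\sum_{x=0}^{p^N-1}f(x)(-1)^x.$$ *)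

theory Defs
  imports "HOL-Analysis.Analysis" "HOL-Computational_Algebra.Computational_Algebra"
begin

definition padic_abs :: "nat \<Rightarrow> rat \<Rightarrow> real" where
  "padic_abs p r =
     (if r = 0 then 0
      else (case quotient_of r of (a, b) \<Rightarrow>
        real p powi (int (multiplicity (int p) b) - int (multiplicity (int p) a))))"

text \<open>
  Valued fields are given by a field type together with an absolute value \<open>v\<close>; all topological
  notions refer to the metric induced by \<open>v\<close>.
\<close>

definition vdist :: "('a::field \<Rightarrow> real) \<Rightarrow> 'a \<Rightarrow> 'a \<Rightarrow> real" where
  "vdist v x y = v (x - y)"

definition vtopology :: "('a::field \<Rightarrow> real) \<Rightarrow> 'a topology" where
  "vtopology v = Metric_space.mtopology UNIV (vdist v)"

definition vlim :: "('a::field \<Rightarrow> real) \<Rightarrow> (nat \<Rightarrow> 'a) \<Rightarrow> 'a" where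
  "vlim v X = (THE l. limitin (vtopology v) X l sequentially)"

locale nonarch_abs =
  fixes v :: "'a::field \<Rightarrow> real"
  assumes nonneg: "0 \<le> v x"
    and eq_0_iff: "v x = 0 \<longleftrightarrow> x = 0"
    and mult: "v (x * y) = v x * v y"
    and ultrametric: "v (x + y) \<le> max (v x) (v y)"

text \<open>
  Inside a complete valued field extending the \<open>p\<close>-adic absolute value of the rationals, the
  closure of the rationals is the completion, that is, the field of \<open>p\<close>-adic numbers.
\<close>

definition Qp :: "('a::field_char_0 \<Rightarrow> real) \<Rightarrow> 'a set" where
  "Qp v = vtopology v closure_of \<rat>"

definition Qp_alg :: "('a::field_char_0 \<Rightarrow> real) \<Rightarrow> 'a set" where
  "Qp_alg v = {x. \<exists>P. P \<noteq> 0 \<and> (\<forall>i. coeff P i \<in> Qp v) \<and> poly P x = 0}"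

text \<open>
  The field \<open>'a\<close> with absolute value \<open>v\<close> is the completion of an algebraic closure of the
  \<open>p\<close>-adic numbers: it is complete, \<open>v\<close> extends the \<open>p\<close>-adic absolute value, and the elements
  algebraic over the \<open>p\<close>-adic numbers form an algebraically closed field which is dense.
  This determines \<open>('a, v)\<close> up to isometric isomorphism.
\<close>

locale padic_complex = nonarch_abs v
  for p :: nat and v :: "'a::field_char_0 \<Rightarrow> real" +
  assumes prime_p: "prime p"
    and abs_of_rat: "v (of_rat r) = padic_abs p r"
    and complete: "Metric_space.mcomplete UNIV (vdist v)"
    and alg_closed: "\<lbrakk>\<And>i. coeff P i \<in> Qp_alg v; 0 < degree P\<rbrakk> \<Longrightarrow> \<exists>x\<in>Qp_alg v. poly P x = 0"
    and dense: "vtopology v closure_of Qp_alg v = UNIV"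

definition padic_pow :: "('a::field_char_0 \<Rightarrow> real) \<Rightarrow> 'a \<Rightarrow> 'a \<Rightarrow> 'a" where
  "padic_pow v q x = vlim v (\<lambda>M. \<Sum>m<M. (x gchoose m) * (q - 1) ^ m)"

definition fermionic_integral ::
    "nat \<Rightarrow> ('a::field_char_0 \<Rightarrow> real) \<Rightarrow> ('a \<Rightarrow> 'a) \<Rightarrow> 'a" where
  "fermionic_integral p v f = vlim v (\<lambda>N. \<Sum>x<p ^ N. f (of_nat x) * (- 1) ^ x)"

lemma (in nonarch_abs) Metric_space_vdist: "Metric_space UNIV (vdist v)"
proof
  have one: "v 1 = 1"
    using mult[of 1 1] eq_0_iff[of 1] by simp
  have "v (- 1) * v (- 1) = 1"
    using mult[of "- 1" "- 1"] one by simp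
  then have "v (- 1) = 1"
    using nonneg[of "- 1"] by (simp add: square_eq_1_iff)
  then have minus: "v (- x) = v x" for x
    using mult[of "- 1" x] by simp
  show "0 \<le> vdist v x y" for x y
    by (simp add: vdist_def nonneg)
  show "vdist v x y = vdist v y x" for x y
    using minus[of "x - y"] by (simp add: vdist_def)
  show "vdist v x y = 0 \<longleftrightarrow> x = y" for x y
    by (simp add: vdist_def eq_0_iff)
  show "vdist v x z \<le> vdist v x y + vdist v y z" for x y z
    using ultrametric[of "x - y" "y - z"] nonneg[of "x - y"] nonneg[of "y - z"]
    by (simp add: vdist_def)
qed

lemma (in nonarch_abs) vlim_eq:
  assumes "limitin (vtopology v) X l sequentially"
  shows "vlim v X = l"
proof -
  interpret Metric_space UNIV "vdist v"
    by (rule Metric_space_vdist)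
  show ?thesis
    unfolding vlim_def using assms
    by (intro the_equality) (auto simp: vtopology_def intro: limitin_metric_unique)
qed

end

theory Submission
  imports Defs
begin

text \<open>
  On natural numbers the integrands are \<open>(1 - x)\<^sup>n q\<^sup>-\<^sup>x\<close> and \<open>g x = x\<^sup>n q\<^sup>x\<close>. Since \<open>v (q - 1) < 1\<close>,
  both \<open>p\<^sup>N\<close> and \<open>q ^ p\<^sup>N - 1\<close> tend to \<open>0\<close>, so a shift of the argument by a multiple of \<open>p\<^sup>N\<close>
  is negligible. Splitting \<open>{..<p\<^sup>N\<^sup>+\<^sup>1}\<close> into \<open>p\<close> blocks of length \<open>p\<^sup>N\<close>, whose signs
  sum to \<open>1\<close> because \<open>p\<close> is odd, shows that the sums of \<open>g\<close> are Cauchy. The reflection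
  \<open>x \<mapsto> p\<^sup>N + 1 - x\<close> turns the first sum into \<open>1 / q\<close> times the alternating sum of \<open>g\<close> over
  \<open>{2..p\<^sup>N + 1}\<close>; compared with \<open>{..<p\<^sup>N}\<close>, the boundary terms contribute \<open>2\<close> in the limit.
\<close>

section \<open>Estimates in a non-archimedean valued field\<close>

context nonarch_abs
begin

lemma abs_v [simp]: "\<bar>v x\<bar> = v x"
  by (simp add: nonneg)

lemma v_zero [simp]: "v 0 = 0"
  by (simp add: eq_0_iff)

lemma v_one [simp]: "v 1 = 1"
  using mult[of 1 1] eq_0_iff[of 1] by simp

lemma v_minus [simp]: "v (- x) = v x"
proof -
  have "v (- 1) * v (- 1) = 1"
    using mult[of "- 1" "- 1"] by simp
  then have "v (- 1) = 1"
    using nonneg[of "- 1"] by (simp add: square_eq_1_iff)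
  then show ?thesis
    using mult[of "- 1" x] by simp
qed

lemma v_minus_commute: "v (x - y) = v (y - x)"
  using v_minus[of "x - y"] by simp

lemma v_power: "v (x ^ n) = v x ^ n"
  by (induction n) (simp_all add: mult)

lemma v_add_le: "v x \<le> B \<Longrightarrow> v y \<le> B \<Longrightarrow> v (x + y) \<le> B"
  using ultrametric[of x y] by linarith

lemma v_diff_le: "v x \<le> B \<Longrightarrow> v y \<le> B \<Longrightarrow> v (x - y) \<le> B"
  using v_add_le[of x B "- y"] by simp

lemma v_sum_le:
  assumes "0 \<le> B" and "\<And>i. i \<in> A \<Longrightarrow> v (f i) \<le> B"
  shows "v (sum f A) \<le> B"
  using assms by (induction A rule: infinite_finite_induct) (auto intro: v_add_le)

lemma v_of_nat_le_1: "v (of_nat k) \<le> 1"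
  by (induction k) (auto intro: v_add_le)

lemma v_mult_le: "v x \<le> 1 \<Longrightarrow> v y \<le> B \<Longrightarrow> v (x * y) \<le> B"
  using mult_mono[of "v x" 1 "v y" B] nonneg[of x] nonneg[of y] by (simp add: mult)

text \<open>In the splitting \<open>a * (b - d) + d * (a - c)\<close> each small difference has a
  cofactor of absolute value at most 1, so chained product estimates keep the same bound
  \<open>B\<close>.\<close>

lemma v_mult_diff_le:
  assumes "v a \<le> 1" "v d \<le> 1" "v (a - c) \<le> B" "v (b - d) \<le> B"
  shows "v (a * b - c * d) \<le> B"
proof -
  have "a * b - c * d = a * (b - d) + d * (a - c)"
    by (simp add: algebra_simps)
  then show ?thesis
    using assms by (auto intro!: v_add_le v_mult_le)
qed

lemma v_power_diff_le:
  assumes "v x \<le> 1" "v y \<le> 1" "v (x - y) \<le> B"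
  shows "v (x ^ n - y ^ n) \<le> B"
proof (induction n)
  case 0
  then show ?case using assms(3) nonneg[of "x - y"] by simp
next
  case (Suc n)
  have "v (y ^ n) \<le> 1"
    using assms(2) nonneg by (simp add: v_power power_le_one)
  with Suc show ?case
    using assms by (auto intro: v_mult_diff_le)
qed

lemma limitin_vtopology_iff:
  "limitin (vtopology v) X l sequentially \<longleftrightarrow> (\<lambda>N. v (X N - l)) \<longlonglongrightarrow> 0"
proof -
  interpret Metric_space UNIV "vdist v"
    by (rule Metric_space_vdist)
  show ?thesis
    by (simp add: vtopology_def limit_metric_sequentially lim_sequentially vdist_def)
qed

text \<open>The ultrametric inequality makes summability of the increments unnecessary.\<close>

lemma limitin_if_increments_tendsto_0:
  assumes complete: "Metric_space.mcomplete UNIV (vdist v)"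
    and incr: "(\<lambda>N. v (X (Suc N) - X N)) \<longlonglongrightarrow> 0"
  obtains l where "limitin (vtopology v) X l sequentially"
proof -
  interpret Metric_space UNIV "vdist v"
    by (rule Metric_space_vdist)
  have "MCauchy X"
    unfolding MCauchy_def
  proof (intro conjI allI impI)
    fix e :: real
    assume "0 < e"
    then obtain N where N: "\<And>m. N \<le> m \<Longrightarrow> v (X (Suc m) - X m) \<le> e / 2"
      using LIMSEQ_D[OF incr, of "e / 2"] by (auto intro: less_imp_le)
    have base: "v (X m - X N) \<le> e / 2" if "N \<le> m" for m
      using that
    proof (induction m rule: dec_induct)
      case base
      then show ?case using \<open>0 < e\<close> by simp
    next
      case (step m)
      have "v ((X (Suc m) - X m) + (X m - X N)) \<le> e / 2"
        using step N by (intro v_add_le) auto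
      then show ?case by simp
    qed
    have "vdist v (X m) (X m') < e" if "N \<le> m" "N \<le> m'" for m m'
    proof -
      have "v ((X m - X N) - (X m' - X N)) \<le> e / 2"
        using base that by (blast intro: v_diff_le[of "X m - X N"])
      then show ?thesis using \<open>0 < e\<close> by (simp add: vdist_def)
    qed
    then show "\<exists>N. \<forall>n n'. N \<le> n \<longrightarrow> N \<le> n' \<longrightarrow> vdist v (X n) (X n') < e"
      by blast
  qed auto
  then show thesis
    using complete that unfolding mcomplete_def vtopology_def by blast
qed

text \<open>Isosceles principle: \<open>1\<close> and \<open>q\<close> bound each other up to a term
  of absolute value below 1.\<close>

lemma v_eq_1_if_near_1: "v (1 - q) < 1 \<Longrightarrow> v q = 1"
  using ultrametric[of q "1 - q"] ultrametric[of 1 "q - 1"] v_minus_commute[of q 1] by auto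

end

text \<open>Each \<open>p\<close>-th power gains a factor \<open>c\<close>: in
  \<open>u ^ p - 1 = (u - 1) * (\<Sum>i<p. u ^ i)\<close> the geometric sum differs from
  \<open>of_nat p\<close> by terms \<open>u ^ i - 1\<close>, all of absolute value at most
  \<open>c\<close>.\<close>

lemma (in nonarch_abs) v_power_prime_power_minus_1:
  assumes q: "v (1 - q) \<le> c" and p: "v (of_nat p) \<le> c" and c: "c \<le> 1"
  shows "v (q ^ p ^ N - 1) \<le> c ^ Suc N"
proof (induction N)
  case 0
  then show ?case using q by (simp add: v_minus_commute)
next
  case (Suc N)
  define u where "u = q ^ p ^ N"
  have c0: "0 \<le> c"
    using q nonneg[of "1 - q"] by linarith
  have u: "v (u - 1) \<le> c ^ Suc N"
    using Suc by (simp add: u_def)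
  have uc: "v (u - 1) \<le> c"
    using u mult_left_le[OF power_le_one[OF c0 c, of N] c0] by simp
  have u1: "v u \<le> 1"
    using v_add_le[of "u - 1" 1 1] uc c by simp
  have "v (u ^ i - 1 ^ i) \<le> c" for i
    using u1 uc by (intro v_power_diff_le) auto
  then have "v ((\<Sum>i<p. u ^ i - 1) + of_nat p) \<le> c"
    using p c0 by (intro v_add_le v_sum_le) auto
  then have "v (\<Sum>i<p. u ^ i) \<le> c"
    by (simp add: sum_subtractf)
  then have "v ((u - 1) * (\<Sum>i<p. u ^ i)) \<le> c ^ Suc N * c"
    unfolding mult using u c0 nonneg by (intro mult_mono) auto
  moreover have "q ^ p ^ Suc N - 1 = (u - 1) * (\<Sum>i<p. u ^ i)"
    unfolding u_def power_diff_1_eq[symmetric] by (simp add: power_mult[symmetric] mult.commute)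
  ultimately show ?case
    by (simp add: mult.commute)
qed

section \<open>Alternating sums: blocks and reflection\<close>

lemma sum_lessThan_mult_blocks:
  "(\<Sum>x<m * k. f x) = (\<Sum>j<k. \<Sum>y<m. f (m * j + y))" for f :: "nat \<Rightarrow> 'b::comm_monoid_add"
proof (induction k)
  case (Suc k)
  have "(\<Sum>x<m * Suc k. f x) = (\<Sum>x<m * k. f x) + (\<Sum>x=m * k..<m * k + m. f x)"
    using sum.atLeastLessThan_concat[of 0 "m * k" "m * k + m" f]
    by (simp add: lessThan_atLeast0 add.commute)
  also have "(\<Sum>x=m * k..<m * k + m. f x) = (\<Sum>y<m. f (m * k + y))"
    using sum.shift_bounds_nat_ivl[of f 0 "m * k" m]
    by (simp add: lessThan_atLeast0 add.commute)
  finally show ?case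
    using Suc by simp
qed simp

lemma sum_minus_1_power_odd: "odd k \<Longrightarrow> (\<Sum>j<k. (- 1) ^ j) = (1::'b::comm_ring_1)"
proof -
  have "(\<Sum>j<k. (- 1) ^ j) = (if odd k then 1 else (0::'b))"
    by (induction k) auto
  then show "odd k \<Longrightarrow> ?thesis" by simp
qed

lemma (in nonarch_abs) v_alternating_sum_blocks_le:
  assumes "odd m" "odd k" "0 \<le> B"
    and shift: "\<And>y j. v (f (m * j + y) - f y) \<le> B"
  shows "v ((\<Sum>x<m * k. f x * (- 1) ^ x) - (\<Sum>x<m. f x * (- 1) ^ x)) \<le> B"
proof -
  have sign: "(- 1) ^ (m * j + y) = ((- 1) ^ j * (- 1) ^ y :: 'a)" for j y
    using \<open>odd m\<close> by (simp add: power_add power_mult)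
  \<comment> \<open>The \<open>k\<close> block signs sum to 1, so a single block equals its
    \<open>k\<close> signed copies and can be compared with the long sum term by term.\<close>
  have "(\<Sum>x<m. f x * (- 1) ^ x) = (\<Sum>j<k. (- 1) ^ j) * (\<Sum>x<m. f x * (- 1) ^ x)"
    using \<open>odd k\<close> by (simp add: sum_minus_1_power_odd)
  also have "\<dots> = (\<Sum>j<k. \<Sum>y<m. f y * (- 1) ^ (m * j + y))"
    unfolding sum_product sign by (simp add: mult_ac)
  finally have "(\<Sum>x<m * k. f x * (- 1) ^ x) - (\<Sum>x<m. f x * (- 1) ^ x) =
      (\<Sum>j<k. \<Sum>y<m. (- 1) ^ (m * j + y) * (f (m * j + y) - f y))"
    by (simp add: sum_lessThan_mult_blocks sum_subtractf right_diff_distrib mult.commute[of "(- 1) ^ _"])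
  then show ?thesis
    using shift \<open>0 \<le> B\<close> by (auto intro!: v_sum_le v_mult_le simp: v_power)
qed

text \<open>As \<open>m + 1\<close> is even, the reflection preserves signs and makes the argument
  run over \<open>{2..m + 1}\<close>. Returning to \<open>{..<m}\<close> exchanges the terms at 0
  and 1 for those at \<open>m\<close> and \<open>m + 1\<close>.\<close>

lemma alternating_sum_reflect:
  fixes g :: "nat \<Rightarrow> 'b::comm_ring_1"
  assumes "odd m"
  shows "(\<Sum>x<m. g (m + 1 - x) * (- 1) ^ x) =
    (\<Sum>x<m. g x * (- 1) ^ x) - g m + g (Suc m) - g 0 + g 1"
proof -
  define h where "h x = g x * (- 1) ^ x" for x
  \<comment> \<open>The form \<open>m - Suc x\<close> is the one that
    \<open>sum.nat_diff_reindex\<close> reverses.\<close>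
  have "(\<Sum>x<m. g (m + 1 - x) * (- 1) ^ x) = (\<Sum>x<m. h (Suc (Suc (m - Suc x))))"
  proof (intro sum.cong refl)
    fix x assume "x \<in> {..<m}"
    then have e: "Suc (Suc (m - Suc x)) = m + 1 - x" and "x \<le> m + 1"
      by auto
    then have "even (m + 1 - x) \<longleftrightarrow> even x"
      using \<open>odd m\<close> by simp
    then have "(- 1) ^ (m + 1 - x) = ((- 1) ^ x :: 'b)"
      by (simp add: minus_one_power_iff)
    then show "g (m + 1 - x) * (- 1) ^ x = h (Suc (Suc (m - Suc x)))"
      unfolding e h_def by simp
  qed
  also have "\<dots> = (\<Sum>x<m. h (Suc (Suc x)))"
    by (rule sum.nat_diff_reindex)
  also have "\<dots> = (\<Sum>x<Suc (Suc m). h x) - h 0 - h 1"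
    by (simp add: sum.lessThan_Suc_shift del: sum.lessThan_Suc)
  finally show ?thesis
    using \<open>odd m\<close> by (simp add: h_def)
qed

section \<open>Powers and the fermionic integral in the p-adic complex field\<close>

context padic_complex
begin

lemma v_of_nat_p_less_1: "v (of_nat p) < 1"
proof -
  have "quotient_of (of_nat p) = (int p, 1)"
    using quotient_of_int[of "int p"] by (simp add: of_int_def)
  then have "v (of_nat p) = inverse (real p)"
    using abs_of_rat[of "of_nat p"] prime_gt_0_nat[OF prime_p] prime_gt_1_nat[OF prime_p]
    by (simp add: padic_abs_def multiplicity_self power_int_minus)
  then show ?thesis
    using prime_gt_1_nat[OF prime_p] by (simp add: inverse_less_1_iff)
qed

text \<open>The coefficients vanish for \<open>m > x\<close>, so the partial sums are eventually the
  binomial expansion of \<open>((q - 1) + 1) ^ x\<close>.\<close>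

lemma padic_pow_of_nat: "padic_pow v q (of_nat x) = q ^ x"
proof -
  have "(\<Sum>m<M. (of_nat x gchoose m) * (q - 1) ^ m) = q ^ x" if "x < M" for M
  proof -
    have "(\<Sum>m<M. (of_nat x gchoose m) * (q - 1) ^ m) =
        (\<Sum>m\<le>x. of_nat (x choose m) * (q - 1) ^ m)"
      using that by (intro sum.mono_neutral_cong_right) (auto simp: binomial_gbinomial[symmetric])
    also have "\<dots> = ((q - 1) + 1) ^ x"
      by (subst binomial_ring) simp
    finally show ?thesis by simp
  qed
  then have "\<forall>\<^sub>F M in sequentially. v ((\<Sum>m<M. (of_nat x gchoose m) * (q - 1) ^ m) - q ^ x) = 0"
    by (intro eventually_sequentiallyI[of "Suc x"]) simp
  then show ?thesis
    unfolding padic_pow_def by (intro vlim_eq) (simp add: limitin_vtopology_iff tendsto_eventually)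
qed

text \<open>The integral samples its integrand only at natural numbers, where
  \<open>padic_pow\<close> is an ordinary power.\<close>

lemma fermionic_integral_cong:
  "(\<And>x. f (of_nat x) = g x) \<Longrightarrow>
    fermionic_integral p v f = vlim v (\<lambda>N. \<Sum>x<p ^ N. g x * (- 1) ^ x)"
  by (simp add: fermionic_integral_def)

theorem fermionic_integral_reflect:
  assumes "odd p" and q: "v (1 - q) < 1" and n: "1 \<le> n"
  shows "fermionic_integral p v (\<lambda>x. padic_pow v (inverse q) x * (1 - x) ^ n) =
         2 + 1 / q * fermionic_integral p v (\<lambda>x. x ^ n * padic_pow v q x)"
proof -
  define g where "g x = of_nat x ^ n * q ^ x" for x
  define f where "f x = inverse q ^ x * (1 - of_nat x) ^ n" for x
  define A where "A N = (\<Sum>x<p ^ N. f x * (- 1) ^ x)" for N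
  define B where "B N = (\<Sum>x<p ^ N. g x * (- 1) ^ x)" for N
  \<comment> \<open>A common rate: \<open>c ^ N\<close> bounds both
    \<open>v (of_nat (p ^ N))\<close> and \<open>v (q ^ p ^ N - 1)\<close>.\<close>
  define c where "c = max (v (1 - q)) (v (of_nat p))"
  have c: "v (1 - q) \<le> c" "v (of_nat p) \<le> c" "0 \<le> c" "c < 1"
    using q v_of_nat_p_less_1 nonneg[of "1 - q"] by (auto simp: c_def)
  have c_lim: "(\<lambda>N. c ^ N) \<longlonglongrightarrow> 0"
    using c by (intro LIMSEQ_power_zero) simp
  have vq: "v q = 1"
    by (rule v_eq_1_if_near_1[OF q])
  then have q0: "q \<noteq> 0"
    by auto
  have viq: "v (inverse q) = 1"
    using mult[of q "inverse q"] q0 vq by simp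
  have odd: "odd (p ^ N)" for N
    using \<open>odd p\<close> by simp
  have vP: "v (of_nat (p ^ N)) \<le> c ^ N" for N
    using c nonneg by (simp add: v_power power_mono)
  have "c ^ Suc N \<le> c ^ N" for N
    using c by (simp add: mult_left_le_one_le)
  then have vqP: "v (q ^ p ^ N - 1) \<le> c ^ N" for N
    using v_power_prime_power_minus_1[of q c p N] c by (meson less_imp_le order_trans)

  have "v (g (p ^ N * j + y) - g y) \<le> c ^ N" for N j y
    unfolding g_def
  proof (intro v_mult_diff_le v_power_diff_le)
    show "v (of_nat (p ^ N * j + y) - of_nat y) \<le> c ^ N"
      using v_mult_le[OF v_of_nat_le_1[of j] vP[of N]] by (simp add: mult.commute)
    have "v ((q ^ p ^ N) ^ j - 1 ^ j) \<le> c ^ N"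
      using vqP by (intro v_power_diff_le) (auto simp: v_power vq)
    then have "v (q ^ y * ((q ^ p ^ N) ^ j - 1)) \<le> c ^ N"
      by (intro v_mult_le) (auto simp: v_power vq)
    then show "v (q ^ (p ^ N * j + y) - q ^ y) \<le> c ^ N"
      by (simp only: power_add power_mult right_diff_distrib mult_1_right mult.commute[of _ "q ^ y"])
    show "v (of_nat (p ^ N * j + y) ^ n) \<le> 1"
      unfolding v_power by (intro power_le_one nonneg v_of_nat_le_1)
  qed (auto simp: v_power vq intro: v_of_nat_le_1 simp del: of_nat_add of_nat_mult)
  \<comment> \<open>\<open>B (Suc N)\<close> consists of \<open>p\<close> blocks of odd length
    \<open>p ^ N\<close>.\<close>
  then have incr: "v (B (Suc N) - B N) \<le> c ^ N" for N
    using v_alternating_sum_blocks_le[OF odd \<open>odd p\<close>, of "c ^ N" g N] c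
    by (simp add: B_def mult.commute)
  have "(\<lambda>N. v (B (Suc N) - B N)) \<longlonglongrightarrow> 0"
    by (rule tendsto_sandwich[OF _ _ tendsto_const c_lim]) (auto simp: nonneg incr)
  then obtain l where l: "limitin (vtopology v) B l sequentially"
    using limitin_if_increments_tendsto_0[OF complete] by blast

  have AB: "v (A N - (2 + 1 / q * B N)) \<le> c ^ N" for N
  proof -
    define P where "P = p ^ N"
    have cN: "0 \<le> c ^ N"
      using c by simp
    \<comment> \<open>Modulo errors of size \<open>c ^ N\<close>, \<open>P + 1 - x\<close> is
      \<open>1 - x\<close> and \<open>q ^ P\<close> is 1.\<close>
    have summand: "v (f x - inverse q * g (P + 1 - x)) \<le> c ^ N" if "x < P" for x
    proof -
      have "inverse q * q ^ (P + 1 - x) = q ^ P * inverse q ^ x"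
        using that q0 by (simp add: power_diff field_simps)
      then have "f x - inverse q * g (P + 1 - x) =
          inverse q ^ x * (1 - of_nat x) ^ n - (q ^ P * inverse q ^ x) * of_nat (P + 1 - x) ^ n"
        by (simp add: f_def g_def mult_ac)
      also have "v \<dots> \<le> c ^ N"
      proof (intro v_mult_diff_le v_power_diff_le)
        show "v (inverse q ^ x) \<le> 1"
          by (simp add: v_power viq)
        show "v (of_nat (P + 1 - x)) \<le> 1" "v (1 - of_nat x) \<le> 1"
          by (auto intro: v_of_nat_le_1 v_diff_le)
        show "v (of_nat (P + 1 - x) ^ n) \<le> 1"
          unfolding v_power by (intro power_le_one nonneg v_of_nat_le_1)
        show "v (1 - of_nat x - of_nat (P + 1 - x)) \<le> c ^ N"
          using that vP[of N] by (simp add: of_nat_diff P_def)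
        have "v (inverse q ^ x * (1 - q ^ P)) \<le> c ^ N"
          using vqP[of N] by (intro v_mult_le) (auto simp: v_power viq P_def v_minus_commute)
        then show "v (inverse q ^ x - q ^ P * inverse q ^ x) \<le> c ^ N"
          by (simp add: algebra_simps)
      qed
      finally show ?thesis .
    qed
    have sum: "v (\<Sum>x<P. (- 1) ^ x * (f x - inverse q * g (P + 1 - x))) \<le> c ^ N"
      using summand by (intro v_sum_le v_mult_le cN) (auto simp: v_power)
    \<comment> \<open>Since \<open>n\<close> is positive, \<open>0 ^ n = 0\<close> and the boundary
      term at \<open>P\<close> is negligible.\<close>
    have "v (of_nat P ^ n - 0 ^ n) \<le> c ^ N"
      using vP[of N] by (intro v_power_diff_le) (auto simp: P_def v_of_nat_le_1 simp del: of_nat_power)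
    then have gP: "v (inverse q * g P) \<le> c ^ N"
      using n by (simp add: g_def mult v_power vq viq power_0_left split: if_splits)
    \<comment> \<open>The boundary term at \<open>Suc P\<close>, divided by \<open>q\<close>,
      supplies one unit of the constant 2.\<close>
    have "inverse q * g (Suc P) - 1 = q ^ P * of_nat (Suc P) ^ n - 1 * 1 ^ n"
      using q0 by (simp add: g_def)
    also have "v \<dots> \<le> c ^ N"
      using vqP[of N] vP[of N]
      by (intro v_mult_diff_le v_power_diff_le v_of_nat_le_1) (auto simp: v_power vq P_def)
    finally have gSucP: "v (inverse q * g (Suc P) - 1) \<le> c ^ N" .
    \<comment> \<open>Here \<open>g 0 = 0\<close> because \<open>n\<close> is positive, and
      \<open>g 1 = q\<close>; divided by \<open>q\<close>, the latter is the other unit of the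
      constant 2.\<close>
    have "(\<Sum>x<P. g (P + 1 - x) * (- 1) ^ x) = B N - g P + g (Suc P) + q"
      using alternating_sum_reflect[of P g] odd n by (simp add: B_def P_def g_def)
    then have "A N - (2 + 1 / q * B N) =
        (\<Sum>x<P. (- 1) ^ x * (f x - inverse q * g (P + 1 - x)))
        + ((inverse q * g (Suc P) - 1) - inverse q * g P)"
      using q0 unfolding A_def P_def[symmetric]
      by (simp add: right_diff_distrib sum_subtractf sum_distrib_left[symmetric] mult_ac
          mult.left_commute[of _ "inverse q"])
         (simp add: field_simps)
    also have "v \<dots> \<le> c ^ N"
      by (rule v_add_le[OF sum v_diff_le[OF gSucP gP]])
    finally show ?thesis .
  qed
  have "(\<lambda>N. v (A N - (2 + 1 / q * l))) \<longlonglongrightarrow> 0"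
  proof (rule tendsto_sandwich[OF _ _ tendsto_const])
    show "(\<lambda>N. max (c ^ N) (v (B N - l))) \<longlonglongrightarrow> 0"
      using tendsto_max[OF c_lim l[unfolded limitin_vtopology_iff]] by simp
    have "v (A N - (2 + 1 / q * l)) \<le> max (c ^ N) (v (B N - l))" for N
    proof -
      \<comment> \<open>Convergence of \<open>B\<close> carries over to \<open>A\<close> since
        \<open>inverse q\<close> has absolute value 1.\<close>
      have "A N - (2 + 1 / q * l) = (A N - (2 + 1 / q * B N)) + inverse q * (B N - l)"
        using q0 by (simp add: field_simps)
      also have "v \<dots> \<le> max (c ^ N) (v (B N - l))"
        using AB[of N] viq by (intro v_add_le v_mult_le) auto
      finally show ?thesis .
    qed
    then show "\<forall>\<^sub>F N in sequentially. v (A N - (2 + 1 / q * l)) \<le> max (c ^ N) (v (B N - l))"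
      by simp
  qed (simp add: nonneg)
  then have "vlim v A = 2 + 1 / q * vlim v B"
    using vlim_eq[OF l] by (simp add: vlim_eq limitin_vtopology_iff)
  moreover have "fermionic_integral p v (\<lambda>x. padic_pow v (inverse q) x * (1 - x) ^ n) = vlim v A"
    unfolding A_def[abs_def] by (rule fermionic_integral_cong) (simp add: f_def padic_pow_of_nat)
  moreover have "fermionic_integral p v (\<lambda>x. x ^ n * padic_pow v q x) = vlim v B"
    unfolding B_def[abs_def] by (rule fermionic_integral_cong) (simp add: g_def padic_pow_of_nat)
  ultimately show ?thesis
    by simp
qed

end

theorem theorem3:
  fixes p n :: nat and v :: "'a::field_char_0 \<Rightarrow> real" and q :: 'a
  assumes "prime p" and "odd p"
    and "padic_complex p v"
    and "v (1 - q) < 1"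
    and "1 \<le> n"
  shows "fermionic_integral p v (\<lambda>x. padic_pow v (inverse q) x * (1 - x) ^ n) =
         2 + 1 / q * fermionic_integral p v (\<lambda>x. x ^ n * padic_pow v q x)"
  using padic_complex.fermionic_integral_reflect[OF assms(3,2,4,5)] .

end
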